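(* Let $k$ be a positive integer. For $a_j, b_j \in (0,\infty)$, $j=0,\ldots,k$, let $$a(x)=a_0\prod_{j=1}^k (x+a_j),\qquad b(x)=b_0\prod_{j=1}^k (x+b_j),\qquad x\in\mathbb{R}_+.$$ The following statements hold: (i) The net $\big\{\frac{1}{b(m)+a(m)n}\big\}_{m,n\in\mathbb{Z}_+}$ is a minimal joint completely monotone net if $$b_1\le a_1\le b_2\le a_2\le\cdots\le b_k\le a_k.$$ (ii) If $\big\{\frac{1}{b(m)+a(m)n}\big\}_{m,n\in\mathbb{Z}_+}$ is a joint completely monotone net, then $$\sum_{j=1}^k\frac{1}{a_j}\le\sum_{j=1}^k\frac{1}{b_j},\qquad \prod_{j=1}^k b_j\le\prod_{j=1}^k a_j,\qquad \sum_{j=1}^k b_j\le\sum_{j=1}^k a_j.$$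
   Context: $\mathbb{Z}_+$ is the set of nonnegative integers and $\mathbb{R}_+$ the set of nonnegative reals. For a real sequence $\{u_k\}_{k\in\mathbb{Z}_+}$ put $\triangle u_k=u_{k+1}-u_k$; the sequence is completely monotone if $(-1)^j\triangle^j u_k\ge 0$ for all $j,k\in\mathbb{Z}_+$. For a real net $\{u_{m,n}\}_{m,n\in\mathbb{Z}_+}$ put $\triangle_1u_{m,n}=u_{m+1,n}-u_{m,n}$ and $\triangle_2u_{m,n}=u_{m,n+1}-u_{m,n}$. The net is joint completely monotone if $(-1)^{i+j}\triangle_1^i\triangle_2^j u_{m,n}\ge 0$ for all $i,j,m,n\in\mathbb{Z}_+$. A joint completely monotone net is minimal if for every $\epsilon>0$ neither of the sequences $\{u_{k,0}-\epsilon\mathbf{1}_{\{0\}}(k)\}_{k\in\mathbb{Z}_+}$ and $\{u_{0,k}-\epsilon\mathbf{1}_{\{0\}}(k)\}_{k\in\mathbb{Z}_+}$ is completely monotone, where $\mathbf{1}_{\{0\}}$ is the indicator function of $\{0\}$. *)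

theory Defs
  imports "HOL-Analysis.Analysis"
begin

definition fwd_diff :: "(nat \<Rightarrow> real) \<Rightarrow> nat \<Rightarrow> real" where
  "fwd_diff u = (\<lambda>k. u (k + 1) - u k)"

definition fwd_diff1 :: "(nat \<Rightarrow> nat \<Rightarrow> real) \<Rightarrow> nat \<Rightarrow> nat \<Rightarrow> real" where
  "fwd_diff1 u = (\<lambda>m n. u (m + 1) n - u m n)"

definition fwd_diff2 :: "(nat \<Rightarrow> nat \<Rightarrow> real) \<Rightarrow> nat \<Rightarrow> nat \<Rightarrow> real" where
  "fwd_diff2 u = (\<lambda>m n. u m (n + 1) - u m n)"

definition completely_monotone :: "(nat \<Rightarrow> real) \<Rightarrow> bool" where
  "completely_monotone u \<longleftrightarrow> (\<forall>j k. (-1) ^ j * (fwd_diff ^^ j) u k \<ge> 0)"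

definition joint_completely_monotone :: "(nat \<Rightarrow> nat \<Rightarrow> real) \<Rightarrow> bool" where
  "joint_completely_monotone u \<longleftrightarrow>
     (\<forall>i j m n. (-1) ^ (i + j) * (fwd_diff1 ^^ i) ((fwd_diff2 ^^ j) u) m n \<ge> 0)"

definition minimal_joint_completely_monotone :: "(nat \<Rightarrow> nat \<Rightarrow> real) \<Rightarrow> bool" where
  "minimal_joint_completely_monotone u \<longleftrightarrow>
     joint_completely_monotone u \<and>
     (\<forall>\<epsilon>>0. \<not> completely_monotone (\<lambda>k. u k 0 - \<epsilon> * indicator {0} k) \<and>
            \<not> completely_monotone (\<lambda>k. u 0 k - \<epsilon> * indicator {0} k))"

text \<open>The value \<open>c 0\<close> is the leading coefficient; the zeros are \<open>- c 1, \<dots>, - c k\<close>.\<close>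

definition factored_poly :: "nat \<Rightarrow> (nat \<Rightarrow> real) \<Rightarrow> real \<Rightarrow> real" where
  "factored_poly k c x = c 0 * (\<Prod>j=1..k. (x + c j))"

definition recip_net :: "(real \<Rightarrow> real) \<Rightarrow> (real \<Rightarrow> real) \<Rightarrow> nat \<Rightarrow> nat \<Rightarrow> real" where
  "recip_net p q = (\<lambda>m n. 1 / (q (real m) + p (real m) * real n))"

end

theory Submission
  imports Defs "HOL-Computational_Algebra.Fundamental_Theorem_Algebra" "HOL-Real_Asymp.Real_Asymp"
begin

text \<open>
  Write \<open>g = b / a\<close>. Up to a positive factor, the \<open>j\<close>-th alternating difference of the net in \<open>n\<close>
  is \<open>1 / a(m) * (\<Prod>i\<le>j. 1 / (g(m) + n + i))\<close>, so joint complete monotonicity means that all these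
  sequences in \<open>m\<close> are completely monotone.

  If the zeros interlace, then \<open>g = c - h\<close> with \<open>c = b 0 / a 0\<close> and \<open>h\<close> completely monotone, and
  \<open>1 / (g + n)\<close> is a geometric series in \<open>h\<close>. Minimality says that the \<open>j\<close>-th differences at \<open>0\<close>
  tend to \<open>0\<close>; this property survives division by \<open>m + \<zeta>\<close> with \<open>Re \<zeta> > 0\<close>.

  Conversely, since \<open>\<Sum>i. 1 / (g + n + i)\<close> diverges, letting \<open>j\<close> tend to infinity in the inequality
  between consecutive terms shows that \<open>g\<close> increases along the naturals, hence \<open>g(m) \<le> b 0 / a 0\<close>:
  \<open>m = 0\<close> bounds the products and \<open>m \<rightarrow> \<infinity>\<close> the sums. The inequality between the sums of reciprocals
  is \<open>g'(0) \<ge> 0\<close>. It comes from the Newton series \<open>F'(0) = - (\<Sum>j\<ge>1. (-1) ^ j \<triangle>^j F(0) / j)\<close>, valid for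
  the rational functions above once \<open>n\<close> is so large that all their poles have negative real part:
  complete monotonicity then gives \<open>F'(0) \<le> 0\<close>, and \<open>j \<rightarrow> \<infinity>\<close> again isolates the sign of \<open>g'(0)\<close>.
\<close>

subsection \<open>Backward differences and completely monotone sequences\<close>

text \<open>The sign is built in: \<open>(bdiff ^^ j) u\<close> is \<open>(-1) ^ j\<close> times the
  \<open>j\<close>-th forward difference. The type is general because complex sequences occur in the
  Newton series.\<close>

definition bdiff :: "(nat \<Rightarrow> 'a::comm_ring_1) \<Rightarrow> nat \<Rightarrow> 'a" where
  "bdiff u = (\<lambda>k. u k - u (Suc k))"

lemma bdiff_funpow_Suc: "(bdiff ^^ Suc j) u k = (bdiff ^^ j) u k - (bdiff ^^ j) u (Suc k)"
  by (simp add: bdiff_def)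

lemma bdiff_funpow_add:
  "(bdiff ^^ j) (\<lambda>k. u k + v k) = (\<lambda>k. (bdiff ^^ j) u k + (bdiff ^^ j) v k)"
  by (induction j) (auto simp: bdiff_def algebra_simps)

lemma bdiff_funpow_cmult: "(bdiff ^^ j) (\<lambda>k. c * u k) = (\<lambda>k. c * (bdiff ^^ j) u k)"
  by (induction j) (auto simp: bdiff_def algebra_simps)

lemma bdiff_funpow_shift: "(bdiff ^^ j) (\<lambda>k. u (Suc k)) = (\<lambda>k. (bdiff ^^ j) u (Suc k))"
  by (induction j) (auto simp: bdiff_def)

lemma bdiff_funpow_const: "(bdiff ^^ j) (\<lambda>k. c) = (\<lambda>k. if j = 0 then c else 0)"
  by (induction j) (auto simp: bdiff_def)

lemma bdiff_funpow_indicator: "(bdiff ^^ j) (indicator {0}) = indicator {0}"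
  by (induction j) (auto simp: bdiff_def fun_eq_iff indicator_def)

lemma bdiff_funpow_of_real:
  "(bdiff ^^ j) (\<lambda>k. of_real (u k)) = (\<lambda>k. of_real ((bdiff ^^ j) u k))"
  by (induction j) (auto simp: bdiff_def)

lemma fwd_diff_funpow: "(fwd_diff ^^ j) u = (\<lambda>k. (-1) ^ j * (bdiff ^^ j) u k)"
  by (induction j) (auto simp: bdiff_def fwd_diff_def algebra_simps)

text \<open>Leibniz rule: the second difference of a linear factor vanishes, so only two terms
  remain. Applied to a quotient by \<open>k + c\<close>, it becomes a recursion for the differences
  of that quotient.\<close>

lemma bdiff_funpow_mult_linear:
  "(bdiff ^^ Suc j) (\<lambda>k. (of_nat k + c) * u k) k =
     (of_nat k + c + of_nat (Suc j)) * (bdiff ^^ Suc j) u k - of_nat (Suc j) * (bdiff ^^ j) u k"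
proof (induction j arbitrary: k)
  case 0
  show ?case by (simp add: bdiff_def algebra_simps)
next
  case (Suc j)
  show ?case
    unfolding bdiff_funpow_Suc[of "Suc j"] Suc.IH
    by (simp add: bdiff_funpow_Suc algebra_simps del: funpow.simps)
qed

text \<open>The right-hand side is the Beta value \<open>B(k + c, j + 1)\<close>, the integral of
  \<open>t powr (k + c - 1) * (1 - t) ^ j\<close> over \<open>[0, 1]\<close>.\<close>

lemma bdiff_funpow_inverse_linear:
  fixes c :: real
  assumes "0 < c"
  shows "(bdiff ^^ j) (\<lambda>k. 1 / (real k + c)) k = fact j / pochhammer (real k + c) (Suc j)"
proof (induction j arbitrary: k)
  case 0
  show ?case by simp
next
  case (Suc j)
  define x where "x = real k + c"
  have x: "0 < x" using assms by (simp add: x_def)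
  have p: "pochhammer (x + 1) j > 0" using x by (intro pochhammer_pos) simp
  have "pochhammer x (Suc j) = x * pochhammer (x + 1) j"
    "pochhammer (x + 1) (Suc j) = pochhammer (x + 1) j * (x + 1 + real j)"
    "pochhammer x (Suc (Suc j)) = x * (pochhammer (x + 1) j * (x + 1 + real j))"
    using pochhammer_rec[of x j] pochhammer_rec[of x "Suc j"]
    by (simp_all add: pochhammer_Suc[of "x + 1"])
  \<comment> \<open>Used with \<open>P = pochhammer (x + 1) j\<close> and \<open>r = real j\<close>:
    the two neighbouring denominators share \<open>P\<close>.\<close>
  moreover have "f / (x * P) - f / (P * (x + 1 + r)) = (1 + r) * f / (x * (P * (x + 1 + r)))"
    if "0 < P" "0 \<le> r" for f P r :: real
    using x that by (simp add: divide_simps add_pos_nonneg) (simp add: algebra_simps)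
  moreover have shift: "real (Suc k) + c = x + 1" "real k + c = x" by (simp_all add: x_def)
  ultimately show ?case
    unfolding bdiff_funpow_Suc Suc.IH shift using p by simp
qed

lemma completely_monotone_iff: "completely_monotone u \<longleftrightarrow> (\<forall>j k. 0 \<le> (bdiff ^^ j) u k)"
proof -
  have "(- 1) ^ j * ((- 1) ^ j * x) = x" for j and x :: real
    by (metis left_minus_one_mult_self)
  then show ?thesis
    by (simp add: completely_monotone_def fwd_diff_funpow)
qed

lemma completely_monotone_nonneg: "completely_monotone u \<Longrightarrow> 0 \<le> u k"
  unfolding completely_monotone_iff by (metis funpow_0)

lemma completely_monotone_bdiff: "completely_monotone u \<Longrightarrow> completely_monotone (bdiff u)"
  unfolding completely_monotone_iff by (metis comp_apply funpow_Suc_right)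

lemma completely_monotone_antimono: "completely_monotone u \<Longrightarrow> u (Suc k) \<le> u k"
  using completely_monotone_nonneg[OF completely_monotone_bdiff, of u k] by (simp add: bdiff_def)

lemma completely_monotone_shift:
  "completely_monotone u \<Longrightarrow> completely_monotone (\<lambda>k. u (Suc k))"
  by (simp add: completely_monotone_iff bdiff_funpow_shift)

lemma completely_monotone_const: "0 \<le> c \<Longrightarrow> completely_monotone (\<lambda>k. c)"
  by (simp add: completely_monotone_iff bdiff_funpow_const)

lemma completely_monotone_cmult:
  "0 \<le> c \<Longrightarrow> completely_monotone u \<Longrightarrow> completely_monotone (\<lambda>k. c * u k)"
  by (simp add: completely_monotone_iff bdiff_funpow_cmult)

lemma completely_monotone_add:
  "completely_monotone u \<Longrightarrow> completely_monotone v \<Longrightarrow> completely_monotone (\<lambda>k. u k + v k)"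
  by (simp add: completely_monotone_iff bdiff_funpow_add)

lemma completely_monotone_sum:
  "(\<And>i. i \<in> I \<Longrightarrow> completely_monotone (u i)) \<Longrightarrow> completely_monotone (\<lambda>k. \<Sum>i\<in>I. u i k)"
  by (induction I rule: infinite_finite_induct)
    (auto intro: completely_monotone_const completely_monotone_add)

text \<open>The discrete product rule turns a difference of \<open>u * v\<close> into a sum of two
  products of completely monotone sequences, with one difference fewer to take. Hence the induction
  generalises over \<open>u\<close> and \<open>v\<close>.\<close>

lemma completely_monotone_mult:
  assumes "completely_monotone u" "completely_monotone v"
  shows "completely_monotone (\<lambda>k. u k * v k)"
proof -
  have "0 \<le> (bdiff ^^ j) (\<lambda>k. u k * v k) k" for j k
    using assms
  proof (induction j arbitrary: u v)
    case 0
    then show ?case by (simp add: completely_monotone_nonneg)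
  next
    case (Suc j)
    have "bdiff (\<lambda>k. u k * v k) = (\<lambda>k. bdiff u k * v k + u (Suc k) * bdiff v k)"
      by (auto simp: bdiff_def algebra_simps)
    then have "(bdiff ^^ Suc j) (\<lambda>k. u k * v k) k =
        (bdiff ^^ j) (\<lambda>k. bdiff u k * v k) k + (bdiff ^^ j) (\<lambda>k. u (Suc k) * bdiff v k) k"
      by (simp add: funpow_Suc_right bdiff_funpow_add del: funpow.simps)
    then show ?case
      using Suc.IH[of "bdiff u" v] Suc.IH[of "\<lambda>k. u (Suc k)" "bdiff v"] Suc.prems
      by (simp add: completely_monotone_bdiff completely_monotone_shift)
  qed
  then show ?thesis by (simp add: completely_monotone_iff)
qed

lemma completely_monotone_prod:
  "(\<And>i. i \<in> I \<Longrightarrow> completely_monotone (u i)) \<Longrightarrow> completely_monotone (\<lambda>k. \<Prod>i\<in>I. u i k)"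
  by (induction I rule: infinite_finite_induct)
    (auto intro: completely_monotone_const completely_monotone_mult)

lemma completely_monotone_power:
  "completely_monotone u \<Longrightarrow> completely_monotone (\<lambda>k. u k ^ n)"
  by (induction n) (auto intro: completely_monotone_const completely_monotone_mult)

text \<open>Each difference is a finite linear combination of values, so pointwise convergence
  preserves its sign.\<close>

lemma completely_monotone_limit:
  assumes "\<And>n. completely_monotone (u n)" "\<And>k. (\<lambda>n. u n k) \<longlonglongrightarrow> v k"
  shows "completely_monotone v"
proof -
  have "(\<lambda>n. (bdiff ^^ j) (u n) k) \<longlonglongrightarrow> (bdiff ^^ j) v k" for j k
    by (induction j arbitrary: k) (auto simp: bdiff_def intro!: tendsto_diff assms)
  then show ?thesis
    using assms(1) unfolding completely_monotone_iff by (blast intro: LIMSEQ_le_const)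
qed

lemma completely_monotone_inverse_linear:
  "0 < c \<Longrightarrow> completely_monotone (\<lambda>k. 1 / (real k + c))"
  by (auto simp: completely_monotone_iff bdiff_funpow_inverse_linear
      intro!: divide_nonneg_nonneg less_imp_le[OF pochhammer_pos])

text \<open>The partial sums of the geometric series in \<open>h / C\<close> are completely
  monotone, and \<open>h k < C\<close> makes them converge.\<close>

lemma completely_monotone_geometric:
  assumes h: "completely_monotone h" and lt: "\<And>k. h k < C"
  shows "completely_monotone (\<lambda>k. 1 / (C - h k))"
proof (rule completely_monotone_limit)
  have C: "0 < C" using completely_monotone_nonneg[OF h] lt by (meson le_less_trans)
  show "completely_monotone (\<lambda>k. \<Sum>p<n. 1 / C * ((1 / C) * h k) ^ p)" for n
    using C h by (intro completely_monotone_sum completely_monotone_cmult completely_monotone_power) auto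
  show "(\<lambda>n. \<Sum>p<n. 1 / C * ((1 / C) * h k) ^ p) \<longlonglongrightarrow> 1 / (C - h k)" for k
  proof -
    have "norm (1 / C * h k) < 1"
      using C lt[of k] completely_monotone_nonneg[OF h, of k] by simp
    then have "(\<lambda>p. 1 / C * ((1 / C) * h k) ^ p) sums (1 / C * (1 / (1 - 1 / C * h k)))"
      by (intro sums_mult geometric_sums)
    moreover have "1 / C * (1 / (1 - 1 / C * h k)) = 1 / (C - h k)"
      using C lt[of k] by (simp add: field_simps)
    ultimately show ?thesis by (simp add: sums_def)
  qed
qed

section \<open>From nets to families of sequences\<close>

lemma fwd_diff2_funpow: "(fwd_diff2 ^^ j) u m n = (fwd_diff ^^ j) (u m) n"
  by (induction j arbitrary: n) (auto simp: fwd_diff2_def fwd_diff_def)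

lemma fwd_diff1_funpow: "(fwd_diff1 ^^ i) u m n = (fwd_diff ^^ i) (\<lambda>m. u m n) m"
  by (induction i arbitrary: m) (auto simp: fwd_diff1_def fwd_diff_def)

text \<open>Both sign factors cancel against those built into \<open>bdiff\<close>, leaving
  sequences in \<open>m\<close> indexed by the order \<open>j\<close> and the base point
  \<open>n\<close> of the difference in the second variable.\<close>

lemma joint_completely_monotone_iff:
  "joint_completely_monotone u \<longleftrightarrow> (\<forall>j n. completely_monotone (\<lambda>m. (bdiff ^^ j) (u m) n))"
proof -
  have "(- 1) ^ (i + j) * (fwd_diff1 ^^ i) ((fwd_diff2 ^^ j) u) m n =
      (bdiff ^^ i) (\<lambda>m. (bdiff ^^ j) (u m) n) m" for i j m n
  proof -
    have "(- 1) ^ (i + j) * (fwd_diff1 ^^ i) ((fwd_diff2 ^^ j) u) m n =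
        (-1) ^ (i + j) * ((-1) ^ i * ((-1) ^ j * (bdiff ^^ i) (\<lambda>m. (bdiff ^^ j) (u m) n) m))"
      unfolding fwd_diff1_funpow fwd_diff2_funpow fwd_diff_funpow bdiff_funpow_cmult by simp
    also have "\<dots> = ((-1) ^ i * (-1) ^ i) * ((-1) ^ j * (-1) ^ j) * (bdiff ^^ i) (\<lambda>m. (bdiff ^^ j) (u m) n) m"
      by (simp only: power_add mult_ac)
    finally show ?thesis by simp
  qed
  then show ?thesis
    unfolding joint_completely_monotone_def completely_monotone_iff by auto
qed

subsection \<open>Decay of high differences\<close>

lemma sum_inverse_shift_unbounded:
  assumes "0 < (c::real)"
  shows "\<exists>n0. \<forall>n\<ge>n0. B \<le> (\<Sum>i<n. 1 / (c + real i))"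
proof -
  have "\<exists>n. B \<le> (\<Sum>i<n. 1 / (c + real i))"
  proof (rule ccontr)
    assume "\<not> ?thesis"
    then have "(\<Sum>i<n. 1 / (c + real i)) \<le> B" for n
      by (simp add: not_le less_imp_le)
    then have "summable (\<lambda>i. 1 / (c + real i))"
      using assms by (intro summableI_nonneg_bounded) auto
    then have "summable (\<lambda>i. max 1 c * (1 / (c + real i)))"
      by (rule summable_mult)
    \<comment> \<open>The constant \<open>max 1 c\<close> makes the shifted series dominate the
      harmonic one for small and large \<open>c\<close> alike.\<close>
    moreover have "norm (inverse (real (Suc i))) \<le> max 1 c * (1 / (c + real i))" for i
    proof -
      have "c + real i \<le> max 1 c + max 1 c * real i"
        by (intro add_mono) (auto simp: mult_le_cancel_right1)
      then show ?thesis using assms by (simp add: field_simps)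
    qed
    ultimately have "summable (\<lambda>i. inverse (real (Suc i)))"
      by (rule summable_comparison_test'[where N = 0])
    then show False
      using not_summable_harmonic[where 'a = real] summable_Suc_iff by blast
  qed
  then obtain n0 where "B \<le> (\<Sum>i<n0. 1 / (c + real i))" ..
  moreover have "(\<Sum>i<n0. 1 / (c + real i)) \<le> (\<Sum>i<n. 1 / (c + real i))" if "n0 \<le> n" for n
    using that assms by (intro sum_mono2) auto
  ultimately show ?thesis by (meson order_trans)
qed

lemma prod_one_plus_inverse_shift_unbounded:
  assumes "0 < (c::real)" "0 < d"
  shows "\<exists>n0. \<forall>n\<ge>n0. B \<le> (\<Prod>i<n. 1 + d / (c + real i))"
proof -
  obtain n0 where n0: "\<forall>n\<ge>n0. B / d \<le> (\<Sum>i<n. 1 / (c + real i))"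
    using sum_inverse_shift_unbounded[OF assms(1)] by blast
  have "B \<le> (\<Prod>i<n. 1 + d / (c + real i))" if "n \<ge> n0" for n
  proof -
    have "B \<le> (\<Sum>i<n. d / (c + real i))"
      using n0 that assms(2) by (simp add: field_simps sum_distrib_right sum_distrib_left)
    also have "\<dots> \<le> (\<Prod>i<n. 1 + d / (c + real i))"
      using assms by (intro sum_le_prod) auto
    finally show ?thesis .
  qed
  then show ?thesis by blast
qed

text \<open>Once \<open>\<eta> j < \<sigma> * e\<close>, the excess of \<open>\<phi>\<close> over
  \<open>e\<close> is divided by at least \<open>1 + \<sigma> / s\<close> at each step, where
  \<open>s\<close> is the running index. The product of these divisors diverges.\<close>

lemma weighted_recursion_tendsto_0:
  fixes \<phi> \<eta> :: "nat \<Rightarrow> real"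
  assumes \<sigma>: "0 < \<sigma>" and nonneg: "\<And>j. 0 \<le> \<phi> j" and \<eta>: "\<eta> \<longlonglongrightarrow> 0"
    and rec: "\<And>j. (real (Suc j) + \<sigma>) * \<phi> (Suc j) \<le> real (Suc j) * \<phi> j + \<eta> (Suc j)"
  shows "\<phi> \<longlonglongrightarrow> 0"
proof (rule LIMSEQ_I)
  fix r :: real assume "0 < r"
  define e where "e = r / 2"
  have e: "0 < e" using \<open>0 < r\<close> by (simp add: e_def)
  have "eventually (\<lambda>j. \<eta> j < \<sigma> * e) sequentially"
    using \<eta> \<sigma> e by (intro order_tendstoD(2)) auto
  then obtain J where J: "\<eta> j < \<sigma> * e" if "j \<ge> J" for j
    by (auto simp: eventually_sequentially)
  define M where "M = max (\<phi> J - e) 0"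
  have step: "max (\<phi> (J + l) - e) 0 * (\<Prod>i<l. 1 + \<sigma> / (real (Suc J) + real i)) \<le> M" for l
  proof (induction l)
    case 0
    show ?case by (simp add: M_def)
  next
    case (Suc l)
    define s where "s = real (Suc J) + real l"
    have s: "0 < s" "real (Suc (J + l)) = s" by (simp_all add: s_def)
    have "(s + \<sigma>) * \<phi> (Suc (J + l)) \<le> s * \<phi> (J + l) + \<sigma> * e"
      using rec[of "J + l"] J[of "Suc (J + l)"] s by simp
    then have "(s + \<sigma>) * (\<phi> (Suc (J + l)) - e) \<le> s * (\<phi> (J + l) - e)"
      by (simp add: algebra_simps)
    also have "\<dots> \<le> s * max (\<phi> (J + l) - e) 0"
      using s by (intro mult_left_mono) auto
    finally have "(s + \<sigma>) * max (\<phi> (Suc (J + l)) - e) 0 \<le> s * max (\<phi> (J + l) - e) 0"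
      using s by (auto simp: max_def)
    then have "max (\<phi> (Suc (J + l)) - e) 0 * (1 + \<sigma> / s) \<le> max (\<phi> (J + l) - e) 0"
      using s by (simp add: field_simps)
    then have "max (\<phi> (Suc (J + l)) - e) 0 * (1 + \<sigma> / s) * (\<Prod>i<l. 1 + \<sigma> / (real (Suc J) + real i))
        \<le> max (\<phi> (J + l) - e) 0 * (\<Prod>i<l. 1 + \<sigma> / (real (Suc J) + real i))"
      using \<sigma> by (intro mult_right_mono prod_nonneg) auto
    with Suc.IH show ?case
      by (simp add: s_def mult_ac)
  qed
  \<comment> \<open>The threshold \<open>M / e + 1\<close> pushes the excess below \<open>e\<close>,
    so that \<open>\<phi> n < 2 * e = r\<close>.\<close>
  obtain n0 where n0: "\<forall>n\<ge>n0. M / e + 1 \<le> (\<Prod>i<n. 1 + \<sigma> / (real (Suc J) + real i))"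
    using prod_one_plus_inverse_shift_unbounded[of "real (Suc J)" \<sigma> "M / e + 1"] \<sigma> by auto
  have "norm (\<phi> n - 0) < r" if "n \<ge> J + n0" for n
  proof -
    define l where "l = n - J"
    have l: "n = J + l" "l \<ge> n0" using that by (simp_all add: l_def)
    have "max (\<phi> n - e) 0 * (M / e + 1)
        \<le> max (\<phi> n - e) 0 * (\<Prod>i<l. 1 + \<sigma> / (real (Suc J) + real i))"
      using n0 l(2) by (intro mult_left_mono) auto
    also have "\<dots> \<le> M" using step[of l] l by simp
    also have "M < e * (M / e + 1)" using e by (simp add: field_simps)
    finally have "max (\<phi> n - e) 0 < e"
      using e by (auto simp: mult_less_cancel_right M_def add_nonneg_pos)
    then have "\<phi> n < e + e" using max.cobounded1[of "\<phi> n - e" 0] by linarith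
    then show ?thesis using nonneg[of n] by (simp add: e_def)
  qed
  then show "\<exists>no. \<forall>n\<ge>no. norm (\<phi> n - 0) < r" by blast
qed

text \<open>The Leibniz rule at \<open>k = 0\<close>, after taking norms, is the weighted recursion.
  The norm condition covers real \<open>c = \<sigma>\<close> as well as complex \<open>c\<close>
  with real part \<open>\<sigma>\<close>.\<close>

lemma bdiff_divide_linear_tendsto_0:
  fixes u :: "nat \<Rightarrow> 'a::real_normed_field"
  assumes u: "(\<lambda>j. (bdiff ^^ j) u 0) \<longlonglongrightarrow> 0"
    and \<sigma>: "0 < \<sigma>" and c: "\<And>j. real j + \<sigma> \<le> norm (of_nat j + c)"
  shows "(\<lambda>j. (bdiff ^^ j) (\<lambda>k. u k / (of_nat k + c)) 0) \<longlonglongrightarrow> 0"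
proof -
  define f where "f = (\<lambda>k. u k / (of_nat k + c))"
  have nz: "of_nat k + c \<noteq> 0" for k
    using c[of k] \<sigma> by auto
  then have u_eq: "u = (\<lambda>k. (of_nat k + c) * f k)" by (auto simp: f_def)
  have rec: "(of_nat (Suc j) + c) * (bdiff ^^ Suc j) f 0 =
      of_nat (Suc j) * (bdiff ^^ j) f 0 + (bdiff ^^ Suc j) u 0" for j
    unfolding u_eq bdiff_funpow_mult_linear by (simp add: algebra_simps del: funpow.simps)
  have "(\<lambda>j. norm ((bdiff ^^ j) f 0)) \<longlonglongrightarrow> 0"
  proof (rule weighted_recursion_tendsto_0[OF \<sigma>])
    show "(\<lambda>j. norm ((bdiff ^^ j) u 0)) \<longlonglongrightarrow> 0"
      using u by (rule tendsto_norm_zero)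
    fix j
    have "(real (Suc j) + \<sigma>) * norm ((bdiff ^^ Suc j) f 0) \<le> norm (of_nat (Suc j) + c) * norm ((bdiff ^^ Suc j) f 0)"
      by (intro mult_right_mono c) simp
    also have "\<dots> = norm (of_nat (Suc j) * (bdiff ^^ j) f 0 + (bdiff ^^ Suc j) u 0)"
      by (simp only: rec flip: norm_mult)
    also have "\<dots> \<le> real (Suc j) * norm ((bdiff ^^ j) f 0) + norm ((bdiff ^^ Suc j) u 0)"
      by (metis norm_mult norm_of_nat norm_triangle_ineq)
    finally show "(real (Suc j) + \<sigma>) * norm ((bdiff ^^ Suc j) f 0)
        \<le> real (Suc j) * norm ((bdiff ^^ j) f 0) + norm ((bdiff ^^ Suc j) u 0)" .
  qed simp
  then show ?thesis
    unfolding f_def by (rule tendsto_norm_zero_cancel)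
qed

text \<open>\<open>bdiff\<close> fixes the indicator of \<open>{0}\<close>, so every difference at
  \<open>0\<close> drops by the same \<open>\<epsilon>\<close> and decay makes it eventually
  negative.\<close>

lemma not_completely_monotone_minus_indicator:
  assumes "(\<lambda>j. (bdiff ^^ j) u 0) \<longlonglongrightarrow> 0" "0 < \<epsilon>"
  shows "\<not> completely_monotone (\<lambda>k. u k - \<epsilon> * indicator {0} k)"
proof
  assume "completely_monotone (\<lambda>k. u k - \<epsilon> * indicator {0} k)"
  then have "completely_monotone (\<lambda>k. u k + (- \<epsilon>) * indicator {0} k)" by simp
  then have *: "\<forall>j k. 0 \<le> (bdiff ^^ j) u k + - \<epsilon> * indicator {0} k"
    unfolding completely_monotone_iff bdiff_funpow_add bdiff_funpow_cmult bdiff_funpow_indicator .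
  have "\<epsilon> \<le> (bdiff ^^ j) u 0" for j
    using *[rule_format, of j 0] by simp
  then have "\<epsilon> \<le> 0"
    using LIMSEQ_le_const[OF assms(1)] by blast
  then show False using assms(2) by simp
qed

section \<open>Differences of the reciprocal net\<close>

lemma bdiff_recip_net:
  assumes "0 < p (real m)" "0 < q (real m)"
  shows "(bdiff ^^ j) (recip_net p q m) n =
    fact j * (1 / p (real m) * (\<Prod>i\<le>j. 1 / (q (real m) / p (real m) + real (n + i))))"
proof -
  have "recip_net p q m = (\<lambda>n. 1 / p (real m) * (1 / (real n + q (real m) / p (real m))))"
    using assms by (auto simp: recip_net_def field_simps)
  moreover have "pochhammer (real n + q (real m) / p (real m)) (Suc j) =
      (\<Prod>i\<le>j. q (real m) / p (real m) + real (n + i))"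
    unfolding pochhammer_prod atLeast0LessThan lessThan_Suc_atMost
    by (intro prod.cong) auto
  moreover have "0 < q (real m) / p (real m)" using assms by simp
  ultimately show ?thesis
    by (simp only: bdiff_funpow_cmult bdiff_funpow_inverse_linear prod_dividef) simp
qed

lemma joint_completely_monotone_recip_net_iff:
  assumes "\<And>m. 0 < p (real m)" "\<And>m. 0 < q (real m)"
  shows "joint_completely_monotone (recip_net p q) \<longleftrightarrow>
    (\<forall>j n. completely_monotone
      (\<lambda>m. 1 / p (real m) * (\<Prod>i\<le>j. 1 / (q (real m) / p (real m) + real (n + i)))))"
proof -
  have "(\<lambda>m. (bdiff ^^ j) (recip_net p q m) n) =
      (\<lambda>m. fact j * (1 / p (real m) * (\<Prod>i\<le>j. 1 / (q (real m) / p (real m) + real (n + i)))))" for j n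
    by (intro ext bdiff_recip_net assms)
  moreover have "0 \<le> fact j * x \<longleftrightarrow> 0 \<le> x" for j and x :: real
    using mult_le_cancel_left_pos[of "fact j" 0 x] by simp
  then have "completely_monotone (\<lambda>m. fact j * v m) \<longleftrightarrow> completely_monotone v" for j v
    by (simp add: completely_monotone_iff bdiff_funpow_cmult)
  ultimately show ?thesis
    unfolding joint_completely_monotone_iff by (simp only:)
qed

subsection \<open>Interlacing zeros\<close>

lemma factored_poly_pos:
  assumes "\<And>j. j \<le> k \<Longrightarrow> 0 < c j" "0 \<le> x"
  shows "0 < factored_poly k c x"
  unfolding factored_poly_def using assms
  by (intro mult_pos_pos prod_pos) (auto intro: add_nonneg_pos)

lemma completely_monotone_inverse_factored_poly:
  assumes "\<And>j. j \<le> k \<Longrightarrow> 0 < c j"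
  shows "completely_monotone (\<lambda>m. 1 / factored_poly k c (real m))"
proof -
  have "completely_monotone (\<lambda>m. 1 / c 0 * (\<Prod>j\<in>{1..k}. 1 / (real m + c j)))"
    using assms
    by (intro completely_monotone_cmult completely_monotone_prod completely_monotone_inverse_linear)
      (auto simp: less_imp_le)
  then show ?thesis by (simp add: factored_poly_def prod_dividef)
qed

lemma completely_monotone_linear_quotient:
  assumes "0 < c" "c \<le> d"
  shows "completely_monotone (\<lambda>m. (real m + d) / (real m + c))"
proof -
  have "completely_monotone (\<lambda>m. 1 + (d - c) * (1 / (real m + c)))"
    using assms by (intro completely_monotone_add completely_monotone_cmult completely_monotone_const
        completely_monotone_inverse_linear) auto
  also have "(\<lambda>m. 1 + (d - c) * (1 / (real m + c))) = (\<lambda>m. (real m + d) / (real m + c))"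
    using assms by (intro ext) (simp add: field_simps)
  finally show ?thesis .
qed

text \<open>Pairing each numerator \<open>x + b i\<close> with the preceding denominator \<open>x + a (i - 1)\<close>
  makes every factor completely monotone.\<close>

lemma completely_monotone_shifted_quotient:
  assumes a: "\<And>j. j \<in> {l..k} \<Longrightarrow> 0 < a j"
    and le: "\<And>j. j \<in> {l..<k} \<Longrightarrow> a j \<le> b (Suc j)" and "l \<le> k"
  shows "completely_monotone (\<lambda>m. (\<Prod>i\<in>{Suc l..k}. real m + b i) / (\<Prod>i\<in>{l..k}. real m + a i))"
  using \<open>l \<le> k\<close> a le
proof (induction rule: inc_induct)
  case base
  then show ?case by (simp add: completely_monotone_inverse_linear)
next
  case (step n)
  have "completely_monotone (\<lambda>m. (real m + b (Suc n)) / (real m + a n) *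
      ((\<Prod>i\<in>{Suc (Suc n)..k}. real m + b i) / (\<Prod>i\<in>{Suc n..k}. real m + a i)))"
    using step by (intro completely_monotone_mult completely_monotone_linear_quotient) auto
  then show ?case
    using step.hyps by (simp add: prod.atLeast_Suc_atMost[of "Suc n" k] prod.atLeast_Suc_atMost[of n k])
qed

text \<open>Peel off the first factor \<open>1 - (a n - b n) / (x + a n)\<close> and call the rest
  \<open>R\<close>: one minus the product is \<open>(1 - R) + (a n - b n) * R / (x + a n)\<close>.
  The last quotient is the shifted one, with one numerator factor fewer.\<close>

lemma completely_monotone_one_minus_quotient:
  assumes a: "\<And>j. j \<in> {l..k} \<Longrightarrow> 0 < a j" and ba: "\<And>j. j \<in> {l..k} \<Longrightarrow> b j \<le> a j"
    and le: "\<And>j. j \<in> {l..<k} \<Longrightarrow> a j \<le> b (Suc j)" and "l \<le> k"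
  shows "completely_monotone (\<lambda>m. 1 - (\<Prod>i\<in>{l..k}. (real m + b i) / (real m + a i)))"
  using \<open>l \<le> k\<close> a ba le
proof (induction rule: inc_induct)
  case base
  have "completely_monotone (\<lambda>m. (a k - b k) * (1 / (real m + a k)))"
    using base by (intro completely_monotone_cmult completely_monotone_inverse_linear) auto
  moreover have "(a k - b k) * (1 / (real m + a k)) = 1 - (real m + b k) / (real m + a k)" for m
    using base(1)[of k] by (simp add: field_simps)
  ultimately show ?case by simp
next
  case (step n)
  define R where "R = (\<lambda>m. \<Prod>i\<in>{Suc n..k}. (real m + b i) / (real m + a i))"
  have "completely_monotone (\<lambda>m. (a n - b n) * ((\<Prod>i\<in>{Suc n..k}. real m + b i) / (\<Prod>i\<in>{n..k}. real m + a i))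
      + (1 - R m))"
    unfolding R_def using step
    by (intro completely_monotone_add completely_monotone_cmult completely_monotone_shifted_quotient) auto
  moreover have "(a n - b n) * ((\<Prod>i\<in>{Suc n..k}. real m + b i) / (\<Prod>i\<in>{n..k}. real m + a i)) + (1 - R m)
      = 1 - (\<Prod>i\<in>{n..k}. (real m + b i) / (real m + a i))" for m
  proof -
    have e1: "(\<Prod>i\<in>{Suc n..k}. real m + b i) / (\<Prod>i\<in>{n..k}. real m + a i) = R m / (real m + a n)"
      using step.hyps by (simp add: R_def prod_dividef prod.atLeast_Suc_atMost[of n k])
    have e2: "(\<Prod>i\<in>{n..k}. (real m + b i) / (real m + a i)) = (real m + b n) / (real m + a n) * R m"
      using step.hyps by (simp add: R_def prod.atLeast_Suc_atMost[of n k])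
    have "0 < real m + a n" using step.prems(1)[of n] step.hyps by simp
    then show ?thesis unfolding e1 e2 by (simp add: field_simps)
  qed
  ultimately show ?case by (simp only:)
qed

lemma factored_poly_quotient:
  "factored_poly k b x / factored_poly k a x = b 0 / a 0 * (\<Prod>i\<in>{1..k}. (x + b i) / (x + a i))"
  by (simp add: factored_poly_def prod_dividef)

lemma joint_completely_monotone_recip_net_interlacing:
  assumes k: "1 \<le> k" and a: "\<And>j. j \<le> k \<Longrightarrow> 0 < a j" and b: "\<And>j. j \<le> k \<Longrightarrow> 0 < b j"
    and ba: "\<And>j. j \<in> {1..k} \<Longrightarrow> b j \<le> a j" and ab: "\<And>j. j \<in> {1..<k} \<Longrightarrow> a j \<le> b (Suc j)"
  shows "joint_completely_monotone (recip_net (factored_poly k a) (factored_poly k b))"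
proof -
  define c where "c = b 0 / a 0"
  define G where "G = (\<lambda>m. \<Prod>i\<in>{1..k}. (real m + b i) / (real m + a i))"
  have c: "0 < c" using a b by (simp add: c_def)
  have G: "0 < G m" for m
    unfolding G_def by (intro prod_pos divide_pos_pos add_nonneg_pos a b) auto
  have H: "completely_monotone (\<lambda>m. 1 - G m)"
    unfolding G_def using a ba ab k by (intro completely_monotone_one_minus_quotient) auto
  have "completely_monotone (\<lambda>m. 1 / (factored_poly k b (real m) / factored_poly k a (real m) + real N))" for N
  proof -
    \<comment> \<open>Here \<open>h = c * (1 - G)\<close>, which stays below \<open>c + N\<close>
      because \<open>G\<close> is positive.\<close>
    have "completely_monotone (\<lambda>m. 1 / ((c + real N) - c * (1 - G m)))"
      using c G by (intro completely_monotone_geometric completely_monotone_cmult H)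
        (auto simp: algebra_simps add_nonneg_pos)
    moreover have "(c + real N) - c * (1 - G m) =
        factored_poly k b (real m) / factored_poly k a (real m) + real N" for m
      by (simp add: factored_poly_quotient c_def G_def algebra_simps)
    ultimately show ?thesis by simp
  qed
  then have "completely_monotone (\<lambda>m. 1 / factored_poly k a (real m) *
      (\<Prod>i\<le>j. 1 / (factored_poly k b (real m) / factored_poly k a (real m) + real (n + i))))" for j n
    using a by (intro completely_monotone_mult completely_monotone_prod
        completely_monotone_inverse_factored_poly)
  moreover have "0 < factored_poly k a (real m)" "0 < factored_poly k b (real m)" for m
    using a b by (auto intro: factored_poly_pos)
  ultimately show ?thesis
    by (subst joint_completely_monotone_recip_net_iff) blast+
qed

section \<open>Minimality\<close>

lemma bdiff_prod_divide_linear_tendsto_0: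
  fixes u :: "nat \<Rightarrow> real"
  assumes "(\<lambda>j. (bdiff ^^ j) u 0) \<longlonglongrightarrow> 0" "finite I" "\<And>i. i \<in> I \<Longrightarrow> 0 < c i"
  shows "(\<lambda>j. (bdiff ^^ j) (\<lambda>m. u m / (\<Prod>i\<in>I. real m + c i)) 0) \<longlonglongrightarrow> 0"
  using assms(2,3)
proof (induction I)
  case empty
  then show ?case using assms(1) by simp
next
  case (insert x I)
  have "(\<lambda>j. (bdiff ^^ j) (\<lambda>m. (u m / (\<Prod>i\<in>I. real m + c i)) / (real m + c x)) 0) \<longlonglongrightarrow> 0"
    using insert by (intro bdiff_divide_linear_tendsto_0[where \<sigma> = "c x"]) auto
  then show ?case using insert.hyps by (simp add: mult.commute)
qed

lemma bdiff_inverse_factored_poly_tendsto_0: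
  assumes k: "1 \<le> k" and c: "\<And>j. j \<le> k \<Longrightarrow> 0 < c j"
  shows "(\<lambda>j. (bdiff ^^ j) (\<lambda>m. 1 / factored_poly k c (real m)) 0) \<longlonglongrightarrow> 0"
proof -
  have "(\<lambda>j. (bdiff ^^ j) (\<lambda>m. 1 / c 0) 0) \<longlonglongrightarrow> 0"
    unfolding bdiff_funpow_const
    by (rule tendsto_eventually) (auto simp: eventually_sequentially intro!: exI[of _ 1])
  then have "(\<lambda>j. (bdiff ^^ j) (\<lambda>m. (1 / c 0) / (\<Prod>i\<in>{1..k}. real m + c i)) 0) \<longlonglongrightarrow> 0"
    using c by (intro bdiff_prod_divide_linear_tendsto_0) auto
  then show ?thesis by (simp add: factored_poly_def)
qed

lemma minimal_recip_net:
  assumes k: "1 \<le> k" and a: "\<And>j. j \<le> k \<Longrightarrow> 0 < a j" and b: "\<And>j. j \<le> k \<Longrightarrow> 0 < b j"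
    and jcm: "joint_completely_monotone (recip_net (factored_poly k a) (factored_poly k b))"
  shows "minimal_joint_completely_monotone (recip_net (factored_poly k a) (factored_poly k b))"
proof -
  let ?u = "recip_net (factored_poly k a) (factored_poly k b)"
  define A B where "A = factored_poly k a 0" "B = factored_poly k b 0"
  have AB: "0 < A" "0 < B" using a b by (auto simp: A_B_def intro: factored_poly_pos)
  have 1: "(\<lambda>j. (bdiff ^^ j) (\<lambda>m. ?u m 0) 0) \<longlonglongrightarrow> 0"
    using bdiff_inverse_factored_poly_tendsto_0[OF k b] by (simp add: recip_net_def)
  \<comment> \<open>The row \<open>m = 0\<close> is \<open>1 / (B + A * n)\<close>, the reciprocal
    of a factored polynomial of degree one with zero \<open>- B / A\<close>.\<close>
  have "(\<lambda>j. (bdiff ^^ j) (\<lambda>m. 1 / factored_poly 1 (\<lambda>j. if j = 0 then A else B / A) (real m)) 0) \<longlonglongrightarrow> 0"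
    using AB by (intro bdiff_inverse_factored_poly_tendsto_0) auto
  moreover have "1 / factored_poly 1 (\<lambda>j. if j = 0 then A else B / A) (real m) = 1 / (B + A * real m)" for m
  proof -
    have "A * (real m + B / A) = B + A * real m" using AB by (simp add: field_simps)
    then show ?thesis by (simp add: factored_poly_def)
  qed
  moreover have "?u 0 = (\<lambda>m. 1 / (B + A * real m))"
    by (simp add: recip_net_def A_B_def)
  ultimately have 2: "(\<lambda>j. (bdiff ^^ j) (?u 0) 0) \<longlonglongrightarrow> 0" by simp
  show ?thesis
    unfolding minimal_joint_completely_monotone_def
    using jcm not_completely_monotone_minus_indicator[OF 1] not_completely_monotone_minus_indicator[OF 2]
    by blast
qed

subsection \<open>Products and sums of the zeros\<close>

text \<open>Derivatives are recorded as value times logarithmic derivative, so that products turn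
  into sums.\<close>

lemma DERIV_mult_log:
  assumes "(f has_field_derivative f x * l) (at x)" "(g has_field_derivative g x * l') (at x)"
  shows "((\<lambda>z. f z * g z) has_field_derivative f x * g x * (l + l')) (at x)"
  using DERIV_mult[OF assms] by (simp add: algebra_simps)

lemma DERIV_prod_log:
  assumes "\<And>i. i \<in> I \<Longrightarrow> (f i has_field_derivative f i x * l i) (at x)"
  shows "((\<lambda>z. \<Prod>i\<in>I. f i z) has_field_derivative (\<Prod>i\<in>I. f i x) * (\<Sum>i\<in>I. l i)) (at x)"
  using assms
proof (induction I rule: infinite_finite_induct)
  case (insert i I)
  then show ?case
    using DERIV_mult_log[of "f i" x "l i" "\<lambda>z. \<Prod>i\<in>I. f i z" "\<Sum>i\<in>I. l i"] by simp
qed auto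

text \<open>If \<open>g\<close> dropped by \<open>d\<close> at some step, comparing the terms at
  \<open>m\<close> and \<open>Suc m\<close> would bound the product of
  \<open>1 + d / (c + i)\<close> over \<open>i \<le> j\<close> by \<open>p (Suc m) / p m\<close> for
  every \<open>j\<close>, although it diverges.\<close>

lemma completely_monotone_imp_antimono_quotient:
  fixes g p :: "nat \<Rightarrow> real"
  assumes cm: "\<And>j. completely_monotone (\<lambda>m. 1 / p m * (\<Prod>i\<le>j. 1 / (g m + real i)))"
    and p: "\<And>m. 0 < p m" and g: "\<And>m. 0 < g m"
  shows "g m \<le> g (Suc m)"
proof (rule ccontr)
  assume less: "\<not> g m \<le> g (Suc m)"
  define c where "c = g (Suc m)"
  define d where "d = g m - c"
  have c: "0 < c" and d: "0 < d" using g less by (auto simp: c_def d_def)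
  obtain n0 where n0: "\<forall>n\<ge>n0. p (Suc m) / p m + 1 \<le> (\<Prod>i<n. 1 + d / (c + real i))"
    using prod_one_plus_inverse_shift_unbounded[OF c d] by blast
  define P Q where "P = (\<Prod>i\<le>n0. g m + real i)" "Q = (\<Prod>i\<le>n0. c + real i)"
  have PQ: "0 < P" "0 < Q"
    unfolding P_Q_def using c g by (auto intro!: prod_pos add_pos_nonneg)
  have "1 / p (Suc m) * (1 / Q) \<le> 1 / p m * (1 / P)"
    using completely_monotone_antimono[OF cm[of n0], of m] by (simp add: P_Q_def c_def prod_dividef)
  then have "P / Q \<le> p (Suc m) / p m"
    using PQ p[of m] p[of "Suc m"] by (simp add: field_simps)
  moreover have "P / Q = (\<Prod>i<Suc n0. 1 + d / (c + real i))"
    unfolding P_Q_def lessThan_Suc_atMost prod_dividef[symmetric]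
    using c by (intro prod.cong) (auto simp: d_def field_simps add_pos_nonneg add_eq_0_iff)
  moreover have "p (Suc m) / p m + 1 \<le> (\<Prod>i<Suc n0. 1 + d / (c + real i))"
    using n0 by (simp del: prod.lessThan_Suc)
  ultimately show False by simp
qed

text \<open>After division by the leading power, both sides are products of
  \<open>1 + c j * y\<close> with \<open>y = 1 / (m + 1)\<close>. The sum of the \<open>c j\<close>
  is the first-order coefficient at \<open>y = 0\<close>.\<close>

lemma sum_le_of_prod_le:
  fixes a b :: "nat \<Rightarrow> real"
  assumes fin: "finite I"
    and le: "\<And>m. (\<Prod>j\<in>I. real m + b j) \<le> (\<Prod>j\<in>I. real m + a j)"
  shows "(\<Sum>j\<in>I. b j) \<le> (\<Sum>j\<in>I. a j)"
proof -
  have lim: "(\<lambda>m. ((\<Prod>j\<in>I. 1 + c j * inverse (real (Suc m))) - 1) / inverse (real (Suc m)))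
      \<longlonglongrightarrow> (\<Sum>j\<in>I. c j)" for c :: "nat \<Rightarrow> real"
  proof -
    have "((\<lambda>y. \<Prod>j\<in>I. 1 + c j * y) has_field_derivative (\<Sum>j\<in>I. c j)) (at 0)"
    proof -
      have "((\<lambda>y. 1 + c j * y) has_field_derivative (1 + c j * 0) * c j) (at 0)" for j
        by (auto intro!: derivative_eq_intros)
      from DERIV_prod_log[of I "\<lambda>j y. 1 + c j * y" 0 c, OF this] show ?thesis by simp
    qed
    then have "((\<lambda>y. ((\<Prod>j\<in>I. 1 + c j * y) - 1) / y) \<longlongrightarrow> (\<Sum>j\<in>I. c j)) (at 0)"
      by (simp add: has_field_derivative_iff)
    moreover have "filterlim (\<lambda>m. inverse (real (Suc m))) (at 0) sequentially"
      using LIMSEQ_inverse_real_of_nat by (auto simp: filterlim_at)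
    ultimately show ?thesis by (rule filterlim_compose)
  qed
  have "((\<Prod>j\<in>I. 1 + b j * inverse (real (Suc m))) - 1) / inverse (real (Suc m))
      \<le> ((\<Prod>j\<in>I. 1 + a j * inverse (real (Suc m))) - 1) / inverse (real (Suc m))" for m
  proof -
    have "(\<Prod>j\<in>I. 1 + c j * inverse (real (Suc m))) = (\<Prod>j\<in>I. real (Suc m) + c j) / real (Suc m) ^ card I" for c :: "nat \<Rightarrow> real"
    proof -
      have "(\<Prod>j\<in>I. real (Suc m) + c j) / real (Suc m) ^ card I = (\<Prod>j\<in>I. (real (Suc m) + c j) / real (Suc m))"
        by (simp add: prod_dividef)
      also have "\<dots> = (\<Prod>j\<in>I. 1 + c j * inverse (real (Suc m)))"
        by (intro prod.cong) (auto simp: field_simps)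
      finally show ?thesis by simp
    qed
    then show ?thesis
      using le[of "Suc m"] by (intro divide_right_mono diff_right_mono) (auto simp: divide_right_mono)
  qed
  then show ?thesis
    by (intro LIMSEQ_le[OF lim lim]) auto
qed

lemma prod_le_of_joint_completely_monotone:
  assumes a: "\<And>j. j \<le> k \<Longrightarrow> 0 < a j" and b: "\<And>j. j \<le> k \<Longrightarrow> 0 < b j"
    and jcm: "joint_completely_monotone (recip_net (factored_poly k a) (factored_poly k b))"
  shows "(\<Prod>j\<in>{1..k}. real m + b j) \<le> (\<Prod>j\<in>{1..k}. real m + a j)"
proof -
  define G where "G = (\<lambda>m. \<Prod>j\<in>{1..k}. (real m + b j) / (real m + a j))"
  define g where "g = (\<lambda>m. factored_poly k b (real m) / factored_poly k a (real m))"
  have pos: "0 < factored_poly k a (real m)" "0 < factored_poly k b (real m)" for m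
    using a b by (auto intro: factored_poly_pos)
  have cm: "completely_monotone (\<lambda>m. 1 / factored_poly k a (real m) * (\<Prod>i\<le>j. 1 / (g m + real (n + i))))" for j n
    using jcm unfolding g_def joint_completely_monotone_recip_net_iff[of "factored_poly k a" "factored_poly k b", OF pos] by blast
  have "g m \<le> g (Suc m)" for m
    using cm[where n = 0] pos by (intro completely_monotone_imp_antimono_quotient[where p = "\<lambda>m. factored_poly k a (real m)"])
      (auto simp: g_def)
  moreover have "g m = b 0 / a 0 * G m" for m
    by (simp add: g_def G_def factored_poly_quotient)
  moreover have "0 < b 0 / a 0" using a b by simp
  ultimately have "incseq G"
    by (intro incseq_SucI) (simp only: mult_le_cancel_left_pos)
  \<comment> \<open>An increasing sequence lies below its limit, and every factor of
    \<open>G\<close> tends to \<open>1\<close>.\<close>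
  moreover have "G \<longlonglongrightarrow> (\<Prod>j\<in>{1..k}. 1)"
    unfolding G_def
  proof (intro tendsto_prod)
    show "(\<lambda>m. (real m + b j) / (real m + a j)) \<longlonglongrightarrow> 1" for j
      by real_asymp
  qed
  ultimately have "G m \<le> 1"
    by (metis incseq_le prod.neutral_const)
  moreover have "0 < (\<Prod>j\<in>{1..k}. real m + a j)"
    using a by (intro prod_pos) (auto intro: add_nonneg_pos)
  ultimately show ?thesis
    by (simp add: G_def prod_dividef)
qed

subsection \<open>Newton series for the derivative\<close>

text \<open>For \<open>u m = \<integral> t ^ m d\<mu>(t)\<close> the derivative at \<open>0\<close> of the interpolating function is
  \<open>\<integral> ln t d\<mu>(t)\<close>; expanding \<open>ln t\<close> in powers of \<open>1 - t\<close> gives the series below. It determines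
  the derivative from the values at the naturals, which fails for arbitrary \<open>F\<close>
  (consider \<open>sin (pi * z)\<close>).\<close>

definition newton_deriv :: "(complex \<Rightarrow> complex) \<Rightarrow> complex \<Rightarrow> bool" where
  "newton_deriv F d \<longleftrightarrow> (F has_field_derivative d) (at 0) \<and>
     (\<lambda>j. (bdiff ^^ j) (\<lambda>m. F (of_nat m)) 0) \<longlonglongrightarrow> 0 \<and>
     (\<lambda>j. (bdiff ^^ Suc j) (\<lambda>m. F (of_nat m)) 0 / of_nat (Suc j)) sums (- d)"

lemma newton_deriv_const: "newton_deriv (\<lambda>z. c) 0"
proof -
  have "(\<lambda>j. if j = 0 then c else 0) \<longlonglongrightarrow> 0"
    by (rule tendsto_eventually) (auto simp: eventually_sequentially intro!: exI[of _ 1])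
  then show ?thesis
    unfolding newton_deriv_def bdiff_funpow_const by simp
qed

lemma newton_deriv_cmult:
  assumes "newton_deriv F d"
  shows "newton_deriv (\<lambda>z. c * F z) (c * d)"
proof -
  have "(\<lambda>j. c * ((bdiff ^^ Suc j) (\<lambda>m. F (of_nat m)) 0 / of_nat (Suc j))) sums (c * - d)"
    using assms unfolding newton_deriv_def by (intro sums_mult) blast
  then show ?thesis
    using assms unfolding newton_deriv_def bdiff_funpow_cmult
    by (auto intro: DERIV_cmult tendsto_mult_right_zero)
qed

lemma newton_deriv_add:
  assumes "newton_deriv F d" "newton_deriv F' d'"
  shows "newton_deriv (\<lambda>z. F z + F' z) (d + d')"
proof -
  have "(\<lambda>j. (bdiff ^^ Suc j) (\<lambda>m. F (of_nat m)) 0 / of_nat (Suc j) +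
      (bdiff ^^ Suc j) (\<lambda>m. F' (of_nat m)) 0 / of_nat (Suc j)) sums (- d + - d')"
    using assms unfolding newton_deriv_def by (intro sums_add) blast+
  then show ?thesis
    using assms unfolding newton_deriv_def bdiff_funpow_add
    by (auto simp: add_divide_distrib intro: DERIV_add tendsto_add_zero)
qed

text \<open>Identities of rational functions may break at poles under division by zero; a half-plane
  containing the naturals and a neighbourhood of \<open>0\<close> is enough.\<close>

lemma newton_deriv_cong:
  assumes "newton_deriv F d" "0 < \<epsilon>" and eq: "\<And>z. - \<epsilon> < Re z \<Longrightarrow> F z = F' z"
  shows "newton_deriv F' d"
proof -
  have "F (of_nat m) = F' (of_nat m)" for m
    using assms(2) by (intro eq) (simp add: less_le_trans[of _ 0])
  moreover have "open {z. - \<epsilon> < Re z}" by (rule open_halfspace_Re_gt)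
  then have "(F has_field_derivative d) (at 0) \<longleftrightarrow> (F' has_field_derivative d) (at 0)"
    using assms(2) by (intro DERIV_cong_ev) (auto simp: eventually_nhds eq intro!: exI[of _ "{z. - \<epsilon> < Re z}"])
  ultimately show ?thesis
    using assms(1) by (simp add: newton_deriv_def)
qed

text \<open>Dividing the Leibniz recursion by \<open>Suc j\<close> leaves \<open>\<zeta>\<close>
  times the Newton term of the quotient \<open>f\<close>, plus a difference that telescopes to
  \<open>- f 0\<close> by decay. The resulting sum matches the quotient rule.\<close>

lemma newton_deriv_divide_linear:
  assumes F: "newton_deriv F d" and \<zeta>: "0 < Re \<zeta>"
  shows "newton_deriv (\<lambda>z. F z / (z + \<zeta>)) ((d * \<zeta> - F 0) / \<zeta>\<^sup>2)"
proof -
  define u where "u = (\<lambda>m. F (of_nat m))"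
  define f where "f = (\<lambda>m. u m / (of_nat m + \<zeta>))"
  have nz: "\<zeta> \<noteq> 0" "of_nat m + \<zeta> \<noteq> 0" for m
    using \<zeta> by (auto simp: complex_eq_iff add_nonneg_eq_0_iff)
  have null: "(\<lambda>j. (bdiff ^^ j) f 0) \<longlonglongrightarrow> 0"
    unfolding f_def
  proof (rule bdiff_divide_linear_tendsto_0[OF _ \<zeta>])
    show "(\<lambda>j. (bdiff ^^ j) u 0) \<longlonglongrightarrow> 0" using F by (simp add: newton_deriv_def u_def)
    show "real j + Re \<zeta> \<le> norm (of_nat j + \<zeta>)" for j
      using complex_Re_le_cmod[of "of_nat j + \<zeta>"] by simp
  qed
  have u_eq: "u = (\<lambda>m. (of_nat m + \<zeta>) * f m)" using nz by (simp add: f_def)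
  have u_sums: "(\<lambda>j. (bdiff ^^ Suc j) u 0 / of_nat (Suc j)) sums (- d)"
    using F by (simp add: newton_deriv_def u_def)
  have tele: "(\<lambda>j. (bdiff ^^ Suc j) f 0 - (bdiff ^^ j) f 0) sums (0 - (bdiff ^^ 0) f 0)"
    using null by (rule telescope_sums)
  have "(bdiff ^^ Suc j) f 0 / of_nat (Suc j) =
      ((bdiff ^^ Suc j) u 0 / of_nat (Suc j) - ((bdiff ^^ Suc j) f 0 - (bdiff ^^ j) f 0)) / \<zeta>" for j
  proof -
    have "(bdiff ^^ Suc j) u 0 = (\<zeta> + of_nat (Suc j)) * (bdiff ^^ Suc j) f 0 - of_nat (Suc j) * (bdiff ^^ j) f 0"
      unfolding u_eq bdiff_funpow_mult_linear by simp
    moreover have "(\<zeta> + n) * x - n * y = \<zeta> * x + n * (x - y)" for n x y :: complex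
      by (simp add: algebra_simps)
    moreover have "x / n = ((\<zeta> * x + n * (x - y)) / n - (x - y)) / \<zeta>" if "n \<noteq> 0" for n x y :: complex
      using that nz by (simp add: field_simps)
    ultimately show ?thesis by (metis of_nat_eq_0_iff nat.distinct(2))
  qed
  moreover have "(\<lambda>j. ((bdiff ^^ Suc j) u 0 / of_nat (Suc j) - ((bdiff ^^ Suc j) f 0 - (bdiff ^^ j) f 0)) / \<zeta>)
      sums ((- d - (0 - (bdiff ^^ 0) f 0)) / \<zeta>)"
    by (intro sums_divide sums_diff u_sums tele)
  moreover have "(- d - (0 - (bdiff ^^ 0) f 0)) / \<zeta> = - ((d * \<zeta> - F 0) / \<zeta>\<^sup>2)"
    using nz by (simp add: f_def u_def field_simps power2_eq_square)
  ultimately have sums: "(\<lambda>j. (bdiff ^^ Suc j) f 0 / of_nat (Suc j)) sums (- ((d * \<zeta> - F 0) / \<zeta>\<^sup>2))"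
    by simp
  have "((\<lambda>z. F z / (z + \<zeta>)) has_field_derivative (d * \<zeta> - F 0) / \<zeta>\<^sup>2) (at 0)"
    using F nz unfolding newton_deriv_def
    by (auto intro!: derivative_eq_intros simp: power2_eq_square)
  then show ?thesis
    using null sums by (simp add: newton_deriv_def f_def u_def del: funpow.simps)
qed

text \<open>The factor is \<open>1 + (c - \<zeta>) / (z + \<zeta>)\<close>. The derivative stays
  existential, since its uniqueness later identifies it.\<close>

lemma newton_deriv_mult_linear_quotient:
  assumes F: "newton_deriv F d" and \<zeta>: "0 < Re \<zeta>"
  shows "\<exists>d'. newton_deriv (\<lambda>z. F z * ((z + c) / (z + \<zeta>))) d'"
proof -
  have "newton_deriv (\<lambda>z. F z + (c - \<zeta>) * (F z / (z + \<zeta>))) (d + (c - \<zeta>) * ((d * \<zeta> - F 0) / \<zeta>\<^sup>2))"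
    by (intro newton_deriv_add newton_deriv_cmult newton_deriv_divide_linear assms)
  then have "newton_deriv (\<lambda>z. F z * ((z + c) / (z + \<zeta>))) (d + (c - \<zeta>) * ((d * \<zeta> - F 0) / \<zeta>\<^sup>2))"
    using \<zeta>
  proof (rule newton_deriv_cong)
    fix z assume "- Re \<zeta> < Re z"
    then have "z + \<zeta> \<noteq> 0" by (auto simp: complex_eq_iff)
    then show "F z + (c - \<zeta>) * (F z / (z + \<zeta>)) = F z * ((z + c) / (z + \<zeta>))"
      by (simp add: field_simps)
  qed
  then show ?thesis ..
qed

lemma newton_deriv_prod_divide_linear:
  assumes "newton_deriv F d" "finite I" "\<And>i. i \<in> I \<Longrightarrow> 0 < Re (\<zeta> i)"
  shows "\<exists>d'. newton_deriv (\<lambda>z. F z / (\<Prod>i\<in>I. z + \<zeta> i)) d'"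
  using assms(2,3)
proof (induction I)
  case empty
  then show ?case using assms(1) by auto
next
  case (insert i I)
  then obtain d' where "newton_deriv (\<lambda>z. F z / (\<Prod>i\<in>I. z + \<zeta> i)) d'" by auto
  from newton_deriv_divide_linear[OF this, of "\<zeta> i"] show ?case
    using insert by (auto simp: mult.commute)
qed

lemma newton_deriv_mult_prod_linear_quotient:
  assumes "newton_deriv F d" "finite I" "\<And>i. i \<in> I \<Longrightarrow> 0 < Re (\<zeta> i)"
  shows "\<exists>d'. newton_deriv (\<lambda>z. F z * (\<Prod>i\<in>I. (z + c i) / (z + \<zeta> i))) d'"
  using assms(2,3)
proof (induction I)
  case empty
  then show ?case using assms(1) by auto
next
  case (insert i I)
  then obtain d' where "newton_deriv (\<lambda>z. F z * (\<Prod>i\<in>I. (z + c i) / (z + \<zeta> i))) d'" by auto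
  from newton_deriv_mult_linear_quotient[OF this, of "\<zeta> i" "c i"] show ?case
    using insert by (auto simp: mult_ac)
qed

text \<open>Every term of the Newton series for \<open>- d\<close> is nonnegative.\<close>

lemma newton_deriv_nonpos:
  assumes F: "newton_deriv F d" and cm: "completely_monotone u"
    and eq: "\<And>m. F (of_nat m) = of_real (u m)"
  shows "Re d \<le> 0"
proof -
  have "(\<lambda>j. complex_of_real ((bdiff ^^ Suc j) u 0 / real (Suc j))) sums (- d)"
    using F unfolding newton_deriv_def eq bdiff_funpow_of_real by simp
  then have sums: "(\<lambda>j. (bdiff ^^ Suc j) u 0 / real (Suc j)) sums (- Re d)"
    by (auto dest: sums_Re)
  have nonneg: "0 \<le> (bdiff ^^ Suc j) u 0 / real (Suc j)" for j
    using cm unfolding completely_monotone_iff by (intro divide_nonneg_nonneg) (blast, simp)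
  have "0 \<le> - Re d"
    by (rule sums_le[OF nonneg sums_zero sums])
  then show ?thesis by simp
qed

subsection \<open>Sums of reciprocals\<close>

definition complex_factored_poly :: "nat \<Rightarrow> (nat \<Rightarrow> real) \<Rightarrow> complex \<Rightarrow> complex" where
  "complex_factored_poly k c z = of_real (c 0) * (\<Prod>j=1..k. (z + of_real (c j)))"

lemma complex_factored_poly_of_real:
  "complex_factored_poly k c (of_real x) = of_real (factored_poly k c x)"
  by (simp add: complex_factored_poly_def factored_poly_def)

lemma DERIV_complex_factored_poly_0:
  assumes "\<And>j. j \<le> k \<Longrightarrow> 0 < c j"
  shows "(complex_factored_poly k c has_field_derivative
    complex_factored_poly k c 0 * of_real (\<Sum>j=1..k. 1 / c j)) (at 0)"
proof -
  have "((\<lambda>z. z + complex_of_real (c j)) has_field_derivative (0 + of_real (c j)) * of_real (1 / c j)) (at 0)"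
    if "j \<in> {1..k}" for j
    using assms[of j] that by (auto intro!: derivative_eq_intros simp flip: of_real_mult)
  then have "((\<lambda>z. \<Prod>j\<in>{1..k}. z + complex_of_real (c j)) has_field_derivative
      (\<Prod>j\<in>{1..k}. 0 + complex_of_real (c j)) * (\<Sum>j\<in>{1..k}. of_real (1 / c j))) (at 0)"
    by (rule DERIV_prod_log)
  from DERIV_cmult[OF this, of "of_real (c 0)"] show ?thesis
    unfolding complex_factored_poly_def[abs_def] by (simp add: mult.assoc)
qed

lemma complex_factored_poly_nonzero:
  assumes "\<And>j. j \<le> k \<Longrightarrow> 0 < c j" "0 \<le> Re z"
  shows "complex_factored_poly k c z \<noteq> 0"
proof -
  have "z + complex_of_real (c j) \<noteq> 0" if "j \<in> {1..k}" for j
    using assms(1)[of j] assms(2) that by (auto simp: complex_eq_iff)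
  then show ?thesis
    using assms(1)[of 0] by (simp add: complex_factored_poly_def)
qed

text \<open>Factor by factor: in the right half-plane \<open>a j \<le> norm (z + a j)\<close>, so
  the shift from \<open>a j\<close> to \<open>b j\<close> costs only a constant multiple.\<close>

lemma complex_factored_poly_bounded_quotient:
  assumes a: "\<And>j. j \<le> k \<Longrightarrow> 0 < a j" and b: "\<And>j. j \<le> k \<Longrightarrow> 0 < b j"
  shows "\<exists>R. \<forall>z. 0 \<le> Re z \<longrightarrow> norm (complex_factored_poly k b z) \<le> R * norm (complex_factored_poly k a z)"
proof -
  define M where "M = (\<lambda>j. 1 + \<bar>b j - a j\<bar> / a j)"
  have factor: "norm (z + of_real (b j)) \<le> M j * norm (z + of_real (a j))"
    if z: "0 \<le> Re z" and j: "j \<le> k" for z j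
  proof -
    have "z + of_real (b j) = (z + of_real (a j)) + of_real (b j - a j)" by simp
    then have "norm (z + of_real (b j)) \<le> norm (z + of_real (a j)) + \<bar>b j - a j\<bar>"
      by (metis norm_triangle_ineq norm_of_real)
    moreover have "a j \<le> norm (z + of_real (a j))"
      using complex_Re_le_cmod[of "z + of_real (a j)"] z by simp
    then have "\<bar>b j - a j\<bar> * 1 \<le> \<bar>b j - a j\<bar> * (norm (z + of_real (a j)) / a j)"
      using a[OF j] by (intro mult_left_mono) auto
    ultimately show ?thesis by (simp add: M_def algebra_simps)
  qed
  have "norm (complex_factored_poly k b z) \<le> (b 0 / a 0 * (\<Prod>j=1..k. M j)) * norm (complex_factored_poly k a z)"
    if z: "0 \<le> Re z" for z
  proof -
    have "(\<Prod>j=1..k. norm (z + of_real (b j))) \<le> (\<Prod>j=1..k. M j * norm (z + of_real (a j)))"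
      using factor[OF z] by (intro prod_mono) auto
    then have "b 0 * (\<Prod>j=1..k. norm (z + of_real (b j))) \<le> b 0 * (\<Prod>j=1..k. M j * norm (z + of_real (a j)))"
      using b[of 0] by (intro mult_left_mono) auto
    then show ?thesis
      using a[of 0] b[of 0] by (simp add: complex_factored_poly_def norm_mult prod_norm[symmetric] prod.distrib mult_ac)
  qed
  then show ?thesis by blast
qed

text \<open>All zeros of \<open>b + t * a\<close> are in the open left half-plane as soon as \<open>t\<close> exceeds
  the supremum of \<open>\<bar>b / a\<bar>\<close> over the right half-plane.\<close>

lemma complex_factored_poly_pencil:
  assumes a: "\<And>j. j \<le> k \<Longrightarrow> 0 < a j" and b: "\<And>j. j \<le> k \<Longrightarrow> 0 < b j"
    and R: "\<And>z. 0 \<le> Re z \<Longrightarrow> norm (complex_factored_poly k b z) \<le> R * norm (complex_factored_poly k a z)"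
    and t: "R < t" "0 \<le> t"
  shows "\<exists>c \<zeta>. (\<forall>i<k. 0 < Re (\<zeta> i)) \<and>
    (\<forall>z. complex_factored_poly k b z + of_real t * complex_factored_poly k a z = c * (\<Prod>i<k. z + \<zeta> i))"
proof -
  define P where "P = (\<lambda>c :: nat \<Rightarrow> real. \<Prod>j=1..k. [:complex_of_real (c j), 1:])"
  have deg: "degree (P c) = k" for c
    unfolding P_def by (subst degree_prod_sum_eq) auto
  have monic: "coeff (P c) k = 1" for c
    using lead_coeff_prod[of "\<lambda>j. [:complex_of_real (c j), 1:]" "{1..k}"] deg[of c] by (simp add: P_def)
  define q where "q = smult (of_real (b 0)) (P b) + smult (of_real (t * a 0)) (P a)"
  have poly_q: "poly q z = complex_factored_poly k b z + of_real t * complex_factored_poly k a z" for z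
    by (simp add: q_def P_def poly_prod complex_factored_poly_def mult_ac add_ac)
  \<comment> \<open>The leading coefficient is positive, so the degree is exactly \<open>k\<close>
    and the factorisation has \<open>k\<close> linear factors.\<close>
  have "coeff q k = of_real (b 0 + t * a 0)"
    by (simp add: q_def monic)
  moreover have "0 < b 0 + t * a 0" using a[of 0] b[of 0] t by (intro add_pos_nonneg) auto
  ultimately have "k \<le> degree q" by (intro le_degree) (metis of_real_eq_0_iff less_irrefl)
  moreover have "degree q \<le> k"
    unfolding q_def by (intro degree_add_le) (auto intro: order_trans[OF degree_smult_le] simp: deg)
  ultimately have deg_q: "degree q = k" by simp
  obtain root where root: "smult (lead_coeff q) (\<Prod>i<degree q. [:- root i, 1:]) = q"
    by (rule complex_poly_decompose')
  have q_eq: "poly q z = lead_coeff q * (\<Prod>i<k. z + - root i)" for z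
    by (subst root[symmetric]) (simp add: poly_prod deg_q)
  have "0 < Re (- root i)" if "i < k" for i
  proof (rule ccontr)
    assume "\<not> ?thesis"
    then have Re: "0 \<le> Re (root i)" by simp
    have "poly q (root i) = 0"
      using that unfolding q_eq by (auto intro: bexI[of _ i])
    then have "complex_factored_poly k b (root i) = - (of_real t * complex_factored_poly k a (root i))"
      by (simp add: poly_q eq_neg_iff_add_eq_0)
    then have "t * norm (complex_factored_poly k a (root i)) = norm (complex_factored_poly k b (root i))"
      using t by (simp add: norm_mult)
    also have "\<dots> \<le> R * norm (complex_factored_poly k a (root i))"
      using Re by (rule R)
    finally show False
      using t complex_factored_poly_nonzero[of k a, OF a Re] by simp
  qed
  then show ?thesis
    using q_eq poly_q by (intro exI[of _ "lead_coeff q"] exI[of _ "\<lambda>i. - root i"]) auto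
qed

text \<open>Numerator and denominator both have \<open>k\<close> linear factors, so they can be
  paired arbitrarily into linear quotients.\<close>

lemma newton_deriv_mult_pencil_quotient:
  assumes F: "newton_deriv F d" and a: "\<And>j. j \<le> k \<Longrightarrow> 0 < a j" and b: "\<And>j. j \<le> k \<Longrightarrow> 0 < b j"
    and R: "\<And>z. 0 \<le> Re z \<Longrightarrow> norm (complex_factored_poly k b z) \<le> R * norm (complex_factored_poly k a z)"
    and t: "R < t" "0 \<le> t"
  shows "\<exists>d'. newton_deriv (\<lambda>z. F z * (complex_factored_poly k a z /
    (complex_factored_poly k b z + of_real t * complex_factored_poly k a z))) d'"
proof -
  obtain c \<zeta> where \<zeta>: "\<forall>i<k. 0 < Re (\<zeta> i)"
    and eq: "\<forall>z. complex_factored_poly k b z + of_real t * complex_factored_poly k a z = c * (\<Prod>i<k. z + \<zeta> i)"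
    using complex_factored_poly_pencil[of k a b R t, OF a b R t] by blast
  obtain d' where "newton_deriv (\<lambda>z. F z * (\<Prod>i<k. (z + of_real (a (Suc i))) / (z + \<zeta> i))) d'"
    using newton_deriv_mult_prod_linear_quotient[OF F, of "{..<k}" \<zeta> "\<lambda>i. of_real (a (Suc i))"] \<zeta> by auto
  from newton_deriv_cmult[OF this, of "of_real (a 0) / c"]
  show ?thesis
    unfolding eq[rule_format]
    by (auto simp: complex_factored_poly_def prod.atLeast1_atMost_eq prod_dividef mult_ac)
qed

text \<open>These functions extend the sequences that characterise joint complete monotonicity to
  complex arguments, with \<open>1 / (g + N)\<close> written as \<open>a / (b + N * a)\<close>. The
  choice \<open>R < real n\<close> moves the poles of every factor into the left half-plane.\<close>

lemma newton_deriv_recip_net_diff: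
  assumes a: "\<And>j. j \<le> k \<Longrightarrow> 0 < a j" and b: "\<And>j. j \<le> k \<Longrightarrow> 0 < b j"
    and R: "\<And>z. 0 \<le> Re z \<Longrightarrow> norm (complex_factored_poly k b z) \<le> R * norm (complex_factored_poly k a z)"
    and n: "R < real n" and fin: "finite I"
  shows "\<exists>d. newton_deriv (\<lambda>z. 1 / complex_factored_poly k a z * (\<Prod>i\<in>I. complex_factored_poly k a z /
    (complex_factored_poly k b z + of_real (real (n + i)) * complex_factored_poly k a z))) d"
  using fin
proof (induction I)
  case empty
  have "\<exists>d. newton_deriv (\<lambda>z. 1 / of_real (a 0) / (\<Prod>j\<in>{1..k}. z + of_real (a j))) d"
    using a by (intro newton_deriv_prod_divide_linear[OF newton_deriv_const]) auto
  then show ?case by (simp add: complex_factored_poly_def)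
next
  case (insert i I)
  then obtain d where d: "newton_deriv (\<lambda>z. 1 / complex_factored_poly k a z * (\<Prod>i\<in>I. complex_factored_poly k a z /
    (complex_factored_poly k b z + of_real (real (n + i)) * complex_factored_poly k a z))) d" by blast
  have "R < real (n + i)" "0 \<le> real (n + i)" using n by simp_all
  from newton_deriv_mult_pencil_quotient[OF d, of k a b R "real (n + i)", OF a b R this]
  show ?case
    by (simp only: prod.insert[OF insert.hyps] mult_ac)
qed

text \<open>The logarithmic derivative of \<open>b / a\<close> at \<open>0\<close> is
  \<open>SB - SA\<close>. Were it negative, the derivatives at \<open>0\<close> of the extended
  sequences would become positive for large \<open>j\<close>, against complete monotonicity.\<close>

lemma sum_inverse_le_of_joint_completely_monotone:
  assumes a: "\<And>j. j \<le> k \<Longrightarrow> 0 < a j" and b: "\<And>j. j \<le> k \<Longrightarrow> 0 < b j"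
    and jcm: "joint_completely_monotone (recip_net (factored_poly k a) (factored_poly k b))"
  shows "(\<Sum>j=1..k. 1 / a j) \<le> (\<Sum>j=1..k. 1 / b j)"
proof (rule ccontr)
  define SA SB where "SA = (\<Sum>j=1..k. 1 / a j)" "SB = (\<Sum>j=1..k. 1 / b j)"
  assume "\<not> (\<Sum>j=1..k. 1 / a j) \<le> (\<Sum>j=1..k. 1 / b j)"
  then have less: "0 < SA - SB" by (simp add: SA_SB_def)
  let ?A = "complex_factored_poly k a" and ?B = "complex_factored_poly k b"
  let ?ra = "factored_poly k a" and ?rb = "factored_poly k b"
  have pos: "0 < ?ra (real m)" "0 < ?rb (real m)" for m
    using a b by (auto intro: factored_poly_pos)
  define A0 B0 where "A0 = ?ra 0" "B0 = ?rb 0"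
  have AB: "0 < A0" "0 < B0" using pos[of 0] by (auto simp: A0_B0_def)
  have AB_complex: "?A 0 = of_real A0" "?B 0 = of_real B0"
    using complex_factored_poly_of_real[of k _ 0] by (simp_all add: A0_B0_def)
  obtain R where R: "\<And>z. 0 \<le> Re z \<Longrightarrow> norm (?B z) \<le> R * norm (?A z)"
    using complex_factored_poly_bounded_quotient[of k a b, OF a b] by blast
  \<comment> \<open>One \<open>n\<close> serves all \<open>j\<close>, so the number of factors can
    grow afterwards.\<close>
  obtain n :: nat where n: "R < real n" using reals_Archimedean2 by blast
  have bound: "(SA - SB) * (\<Sum>i\<le>j. B0 / (B0 + real (n + i) * A0)) \<le> SA" for j
  proof -
    define F where "F = (\<lambda>z. 1 / ?A z * (\<Prod>i\<le>j. ?A z / (?B z + of_real (real (n + i)) * ?A z)))"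
    define f where "f = 1 / A0 * (\<Prod>i\<le>j. A0 / (B0 + real (n + i) * A0))"
    \<comment> \<open>The logarithmic derivative of \<open>F\<close> at \<open>0\<close>: in each
      factor the contributions \<open>real (n + i) * A0 * SA\<close> cancel, leaving a multiple of
      \<open>SA - SB\<close>.\<close>
    define L where "L = - SA + (\<Sum>i\<le>j. (SA - SB) * (B0 / (B0 + real (n + i) * A0)))"
    have den: "0 < B0 + real i * A0" for i using AB by (intro add_pos_nonneg) auto
    have f: "0 < f" using AB den by (auto simp: f_def intro!: mult_pos_pos prod_pos divide_pos_pos simp del: of_nat_add)
    obtain d where d: "newton_deriv F d"
      using newton_deriv_recip_net_diff[of k a b R n "{..j}", OF a b R n] unfolding F_def by blast
    have dA: "(?A has_field_derivative ?A 0 * of_real SA) (at 0)"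
      and dB: "(?B has_field_derivative ?B 0 * of_real SB) (at 0)"
      unfolding SA_SB_def using a b by (intro DERIV_complex_factored_poly_0; simp)+
    have 1: "((\<lambda>z. 1 / ?A z) has_field_derivative 1 / ?A 0 * of_real (- SA)) (at 0)"
      using AB by (auto intro!: derivative_eq_intros dA simp: AB_complex field_simps)
    have 2: "((\<lambda>z. ?A z / (?B z + of_real (real i) * ?A z)) has_field_derivative
        ?A 0 / (?B 0 + of_real (real i) * ?A 0) * of_real ((SA - SB) * (B0 / (B0 + real i * A0)))) (at 0)" for i
    proof -
      have "?B 0 + of_real (real i) * ?A 0 \<noteq> 0"
        unfolding AB_complex using den[of i] by (metis of_real_add of_real_mult of_real_eq_0_iff less_irrefl)
      moreover have "complex_of_real B0 + of_real (real i) * of_real A0 = of_real (B0 + real i * A0)" by simp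
      ultimately show ?thesis
        by (auto intro!: derivative_eq_intros dA dB simp: AB_complex simp del: of_real_of_nat_eq
            simp flip: of_real_mult of_real_add of_real_diff of_real_divide)
          (simp add: algebra_simps)
    qed
    have "(F has_field_derivative F 0 * of_real L) (at 0)"
      unfolding F_def L_def of_real_add of_real_sum
      by (intro DERIV_mult_log[of "\<lambda>z. 1 / ?A z"] DERIV_prod_log 1 2)
    moreover have "F 0 = of_real f"
      by (simp add: F_def f_def AB_complex)
    ultimately have "d = of_real (f * L)"
      using d DERIV_unique unfolding newton_deriv_def by fastforce
    moreover have "Re d \<le> 0"
    proof (rule newton_deriv_nonpos[OF d])
      show "completely_monotone (\<lambda>m. 1 / ?ra (real m) * (\<Prod>i\<le>j. 1 / (?rb (real m) / ?ra (real m) + real (n + i))))"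
        using jcm joint_completely_monotone_recip_net_iff[of ?ra ?rb, OF pos] by blast
      fix m
      have "?A (of_nat m) = of_real (?ra (real m))" "?B (of_nat m) = of_real (?rb (real m))"
        using complex_factored_poly_of_real[of k _ "real m"] by simp_all
      moreover have "1 / (?rb (real m) / ?ra (real m) + x) = ?ra (real m) / (?rb (real m) + x * ?ra (real m))" for x
        using pos[of m] by (simp add: field_simps)
      ultimately show "F (of_nat m) = of_real (1 / ?ra (real m) * (\<Prod>i\<le>j. 1 / (?rb (real m) / ?ra (real m) + real (n + i))))"
        by (simp add: F_def)
    qed
    ultimately have "L \<le> 0" using f by (simp add: mult_le_0_iff)
    then show ?thesis by (simp add: L_def sum_distrib_left)
  qed
  define g where "g = B0 / A0"
  have g: "0 < g" using AB by (simp add: g_def)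
  \<comment> \<open>The extra \<open>1\<close> makes the left side of \<open>bound\<close> reach
    \<open>SA + (SA - SB)\<close>, which exceeds \<open>SA\<close>.\<close>
  obtain n0 where n0: "\<forall>m\<ge>n0. (SA / (SA - SB) + 1) / g \<le> (\<Sum>i<m. 1 / (g + real n + real i))"
    using sum_inverse_shift_unbounded[of "g + real n"] g by (meson add_pos_nonneg of_nat_0_le_iff)
  have "B0 / (B0 + real (n + i) * A0) = g * (1 / (g + real n + real i))" for i
    using AB by (simp add: g_def field_simps)
  then have "(\<Sum>i\<le>n0. B0 / (B0 + real (n + i) * A0)) = g * (\<Sum>i<Suc n0. 1 / (g + real n + real i))"
    unfolding lessThan_Suc_atMost by (simp only: sum_distrib_left)
  also have "\<dots> \<ge> g * ((SA / (SA - SB) + 1) / g)"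
    using n0 g by (intro mult_left_mono) (simp_all del: sum.lessThan_Suc)
  finally have "SA / (SA - SB) + 1 \<le> (\<Sum>i\<le>n0. B0 / (B0 + real (n + i) * A0))"
    using g by simp
  then have "(SA - SB) * (SA / (SA - SB) + 1) \<le> SA"
    using bound[of n0] less by (meson mult_left_mono less_imp_le order_trans)
  moreover have "(SA - SB) * (SA / (SA - SB) + 1) = SA + (SA - SB)"
    using less by (simp add: field_simps)
  ultimately show False using less by simp
qed

theorem theorem1p4:
  fixes k :: nat and a b :: "nat \<Rightarrow> real"
  assumes "k \<ge> 1"
    and "\<And>j. j \<le> k \<Longrightarrow> a j > 0"
    and "\<And>j. j \<le> k \<Longrightarrow> b j > 0"
  shows "((\<forall>j\<in>{1..k}. b j \<le> a j) \<and> (\<forall>j\<in>{1..<k}. a j \<le> b (j + 1)) \<longrightarrow>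
            minimal_joint_completely_monotone (recip_net (factored_poly k a) (factored_poly k b)))
       \<and> (joint_completely_monotone (recip_net (factored_poly k a) (factored_poly k b)) \<longrightarrow>
            (\<Sum>j=1..k. 1 / a j) \<le> (\<Sum>j=1..k. 1 / b j) \<and>
            (\<Prod>j=1..k. b j) \<le> (\<Prod>j=1..k. a j) \<and>
            (\<Sum>j=1..k. b j) \<le> (\<Sum>j=1..k. a j))"
proof (intro conjI impI)
  let ?net = "recip_net (factored_poly k a) (factored_poly k b)"
  {
    assume "(\<forall>j\<in>{1..k}. b j \<le> a j) \<and> (\<forall>j\<in>{1..<k}. a j \<le> b (j + 1))"
    then show "minimal_joint_completely_monotone ?net"
      using assms by (intro minimal_recip_net joint_completely_monotone_recip_net_interlacing) auto
  }
  assume jcm: "joint_completely_monotone ?net"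
  note prod_le = prod_le_of_joint_completely_monotone[OF assms(2,3) jcm]
  show "(\<Sum>j=1..k. 1 / a j) \<le> (\<Sum>j=1..k. 1 / b j)"
    using assms(2,3) jcm by (rule sum_inverse_le_of_joint_completely_monotone)
  show "(\<Prod>j=1..k. b j) \<le> (\<Prod>j=1..k. a j)"
    using prod_le[of 0] by simp
  show "(\<Sum>j=1..k. b j) \<le> (\<Sum>j=1..k. a j)"
    using prod_le by (intro sum_le_of_prod_le) auto
qed

end
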